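(* Let $S\subseteq \mathbb{N}\times\mathbb{N}$ with $(0,0)\notin S$. Suppose $S$ contains all proper horizontal steps $(a,0)$, $a>0$, and satisfies the slope condition for the boundary $(i+1)_{i\ge 0}=(1,2,3,\ldots)$. Then, as formal power series, $$P(t)=\frac{D_0(t)+D_1(t)+D_2(t)+\cdots}{1+(2-T(t))\,(D_1(t)+D_2(t)+\cdots)}.$$
   Context: $\mathbb{N}$ is the set of non-negative integers. An $S$-path from $(n_0,m_0)$ to $(n,m)$ is a finite (possibly empty) sequence of steps $(a_1,b_1),\ldots,(a_k,b_k)$ in $S$ with $(n_0+a_1+\cdots+a_k,\,m_0+b_1+\cdots+b_k)=(n,m)$. Its nodes are the starting point and the points reached after each step. Let $\underline{s}=(s_i)_{i\ge 0}$ be a non-decreasing sequence of positive integers. An $S$-path starting at $(0,0)$ has (right) boundary $\underline{s}$ if every node of the form $(x,i)$ satisfies $x<s_i$ (equivalently, for the step sets considered here, the path viewed as a piecewise linear path lies strictly to the left of the union of the segments joining $(s_i,i)$ to $(s_{i+1},i+1)$, $i\ge 0$). $S$ satisfies the slope condition for the boundary $\underline{s}$ if for every $(a,b)\in S$ with $b\ne 0$ and every index $i\ge 0$, $s_{i+j}>s_i-1+ja/b$ for all $j=1,\ldots,b$. $a_{n,m}$ is the number of $S$-paths from $(0,0)$ to $(n,m)$. $p_n$ is the number of $S$-paths from $(0,0)$ to $(n,n)$ with right boundary $(i+1)_{i\ge 0}$ (Catalan $S$-paths). Generating functions: $P(t)=\sum_{n\ge 0}p_nt^n$, $D_h(t)=\sum_{n\ge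 h}a_{n-h,n}t^n$ for integers $h\ge 0$, and $T(t)=\sum_{a\in I}t^a$ where $I=\{a:(a,a)\in S\}$. *)

theory Defs
  imports
    "HOL-Library.Product_Plus"
    "HOL-Computational_Algebra.Formal_Power_Series"
begin

definition S_paths :: "(nat \<times> nat) set \<Rightarrow> nat \<times> nat \<Rightarrow> nat \<times> nat \<Rightarrow> (nat \<times> nat) list set" where
  "S_paths S p q = {xs. set xs \<subseteq> S \<and> p + sum_list xs = q}"

definition path_nodes :: "nat \<times> nat \<Rightarrow> (nat \<times> nat) list \<Rightarrow> (nat \<times> nat) set" where
  "path_nodes p xs = {p + sum_list (take k xs) | k. k \<le> length xs}"

definition has_right_boundary :: "(nat \<Rightarrow> nat) \<Rightarrow> (nat \<times> nat) list \<Rightarrow> bool" where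
  "has_right_boundary s xs \<longleftrightarrow> (\<forall>x i. (x, i) \<in> path_nodes (0, 0) xs \<longrightarrow> x < s i)"

definition slope_condition :: "(nat \<times> nat) set \<Rightarrow> (nat \<Rightarrow> nat) \<Rightarrow> bool" where
  "slope_condition S s \<longleftrightarrow>
     (\<forall>(a, b) \<in> S. b \<noteq> 0 \<longrightarrow>
        (\<forall>i. \<forall>j\<in>{1..b}. (of_nat (s (i + j)) :: rat) > of_nat (s i) - 1 + of_nat j * of_nat a / of_nat b))"

text \<open>The following cardinalities are of finite sets as soon as the step \<open>(0, 0)\<close> is
  excluded, see \<open>finite_S_paths\<close>.\<close>

definition num_paths :: "(nat \<times> nat) set \<Rightarrow> nat \<Rightarrow> nat \<Rightarrow> nat" where
  "num_paths S n m = card (S_paths S (0, 0) (n, m))"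

definition num_catalan_paths :: "(nat \<times> nat) set \<Rightarrow> nat \<Rightarrow> nat" where
  "num_catalan_paths S n =
     card {xs \<in> S_paths S (0, 0) (n, n). has_right_boundary (\<lambda>i. i + 1) xs}"

definition catalan_gf :: "(nat \<times> nat) set \<Rightarrow> rat fps" where
  "catalan_gf S = Abs_fps (\<lambda>n. of_nat (num_catalan_paths S n))"

definition diagonal_gf :: "(nat \<times> nat) set \<Rightarrow> nat \<Rightarrow> rat fps" where
  "diagonal_gf S h = Abs_fps (\<lambda>n. if n \<ge> h then of_nat (num_paths S (n - h) n) else 0)"

definition diagonal_steps_gf :: "(nat \<times> nat) set \<Rightarrow> rat fps" where
  "diagonal_steps_gf S = Abs_fps (\<lambda>n. if (n, n) \<in> S then 1 else 0)"

lemma finite_S_paths: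
  assumes "(0, 0) \<notin> S"
  shows "finite (S_paths S p q)"
proof -
  have le: "x \<in> set xs \<Longrightarrow> fst x \<le> fst (sum_list xs) \<and> snd x \<le> snd (sum_list xs)"
    for x :: "nat \<times> nat" and xs
    by (induction xs) auto
  have len: "(0, 0) \<notin> set xs \<Longrightarrow> length xs \<le> fst (sum_list xs) + snd (sum_list xs)"
    for xs :: "(nat \<times> nat) list"
  proof (induction xs)
    case (Cons x xs)
    then show ?case by (cases x) auto
  qed simp
  have "S_paths S p q \<subseteq>
      {xs. set xs \<subseteq> {..fst q} \<times> {..snd q} \<and> length xs \<le> fst q + snd q}"
  proof
    fix xs assume "xs \<in> S_paths S p q"
    then have xs: "set xs \<subseteq> S" "p + sum_list xs = q"
      by (auto simp: S_paths_def)
    have q: "fst (sum_list xs) \<le> fst q" "snd (sum_list xs) \<le> snd q"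
      using xs(2) by auto
    have "set xs \<subseteq> {..fst q} \<times> {..snd q}"
      using le[of _ xs] q by (force intro: order_trans)
    moreover have "length xs \<le> fst q + snd q"
      using len[of xs] xs(1) assms q by fastforce
    ultimately show "xs \<in> {xs. set xs \<subseteq> {..fst q} \<times> {..snd q} \<and> length xs \<le> fst q + snd q}"
      by simp
  qed
  then show ?thesis
    by (rule finite_subset) (rule finite_lists_length_le, simp)
qed

text \<open>The infinite sums of the \<open>D\<^sub>h\<close> converge in the topology of formal power series,
  because the coefficient of \<open>t^n\<close> in \<open>D\<^sub>h\<close> vanishes for \<open>h > n\<close>.\<close>

lemma diagonal_gf_sums:
  "(\<lambda>h. diagonal_gf S (k + h)) sums
     Abs_fps (\<lambda>n. \<Sum>h | k + h \<le> n. of_nat (num_paths S (n - (k + h)) n))"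
  unfolding sums_def
proof (rule tendsto_fpsI)
  fix n
  show "\<forall>\<^sub>F m in sequentially. fps_nth (\<Sum>h<m. diagonal_gf S (k + h)) n =
    fps_nth (Abs_fps (\<lambda>n. \<Sum>h | k + h \<le> n. of_nat (num_paths S (n - (k + h)) n))) n"
    using eventually_gt_at_top[of n]
  proof eventually_elim
    case (elim m)
    have "(\<Sum>h<m. fps_nth (diagonal_gf S (k + h)) n) =
        (\<Sum>h | k + h \<le> n. of_nat (num_paths S (n - (k + h)) n))"
      using elim by (intro sum.mono_neutral_cong_right) (auto simp: diagonal_gf_def)
    then show ?case by (simp add: fps_sum_nth)
  qed
qed

lemma summable_diagonal_gf: "summable (diagonal_gf S)"
  using diagonal_gf_sums[of S 0] by (auto intro: sums_summable)

lemma summable_diagonal_gf_Suc: "summable (\<lambda>h. diagonal_gf S (Suc h))"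
  using diagonal_gf_sums[of S 1] by (auto intro: sums_summable)

text \<open>Constant term of a denominator \<open>1 + X * (D\<^sub>1 + D\<^sub>2 + \<dots>)\<close>; hence the
  division by it is multiplication with the inverse power series.\<close>

lemma denominator_nth_0:
  "fps_nth (1 + X * (\<Sum>h. diagonal_gf S (Suc h))) 0 = 1"
proof -
  have "(\<Sum>h. diagonal_gf S (Suc h)) =
      Abs_fps (\<lambda>n. \<Sum>h | 1 + h \<le> n. of_nat (num_paths S (n - (1 + h)) n))"
    using diagonal_gf_sums[of S 1, THEN sums_unique] by simp
  then have "fps_nth (\<Sum>h. diagonal_gf S (Suc h)) 0 = 0" by simp
  then show ?thesis by simp
qed

end

theory Submission
  imports Defs
begin

text \<open>
  For the boundary \<open>(1, 2, 3, \<dots>)\<close> the slope condition says that every non-horizontal step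
  \<open>(a, b)\<close> has \<open>a \<le> b\<close>. So only horizontal steps lower the height \<open>y - x\<close>, and a horizontal step
  of every length is available. Let \<open>E = D\<^sub>1 + D\<^sub>2 + \<dots>\<close> count the paths that end at positive height,
  and let \<open>W\<close> count the paths, with arbitrary end, that never reach negative height.
  Cutting a path that ends at height 0 at its first step to negative height, and forgetting
  this step, gives a path counted by \<open>W\<close> and one counted by \<open>E\<close>. The forgotten step is
  horizontal and its length is determined by the end point, so \<open>D\<^sub>0 = P + W E\<close>.
  The last step of a nonempty Catalan path either is diagonal and starts at height 0, or is
  horizontal and starts at positive height, so \<open>P = 1 + P T + (W - P)\<close>.
  Eliminating \<open>W\<close> gives \<open>D\<^sub>0 + E = P (1 + (2 - T) E)\<close>.
\<close>

section \<open>Generating functions of weighted sets\<close>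

text \<open>Since \<open>card\<close> of an infinite set is 0, additivity and multiplicativity of
  \<open>weight_gf\<close> are safe only under this guard.\<close>

definition finite_fibres :: "('a \<Rightarrow> nat) \<Rightarrow> 'a set \<Rightarrow> bool" where
  "finite_fibres w A \<longleftrightarrow> (\<forall>n. finite {x \<in> A. w x = n})"

definition weight_gf :: "('a \<Rightarrow> nat) \<Rightarrow> 'a set \<Rightarrow> rat fps" where
  "weight_gf w A = Abs_fps (\<lambda>n. of_nat (card {x \<in> A. w x = n}))"

lemma finite_fibres_subset: "finite_fibres w B \<Longrightarrow> A \<subseteq> B \<Longrightarrow> finite_fibres w A"
  unfolding finite_fibres_def by (auto intro: rev_finite_subset)

lemma weight_gf_Un:
  assumes "finite_fibres w A" "finite_fibres w B" "A \<inter> B = {}"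
  shows "weight_gf w (A \<union> B) = weight_gf w A + weight_gf w B"
proof (rule fps_ext)
  fix n
  have "{x \<in> A \<union> B. w x = n} = {x \<in> A. w x = n} \<union> {x \<in> B. w x = n}" by auto
  then have "card {x \<in> A \<union> B. w x = n} = card {x \<in> A. w x = n} + card {x \<in> B. w x = n}"
    using assms by (auto simp: finite_fibres_def intro!: card_Un_disjoint)
  then show "fps_nth (weight_gf w (A \<union> B)) n = fps_nth (weight_gf w A + weight_gf w B) n"
    by (simp add: weight_gf_def)
qed

lemma weight_gf_bij_betw:
  assumes "bij_betw f A B" and w: "\<And>x. x \<in> A \<Longrightarrow> w' (f x) = w x"
  shows "weight_gf w' B = weight_gf w A"
proof (rule fps_ext)
  fix n
  have "bij_betw f {x \<in> A. w x = n} {y \<in> B. w' y = n}"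
    using assms by (auto simp: bij_betw_def inj_on_def)
  from bij_betw_same_card[OF this] show "fps_nth (weight_gf w' B) n = fps_nth (weight_gf w A) n"
    by (simp add: weight_gf_def)
qed

lemma weight_gf_Times:
  assumes "finite_fibres v A" "finite_fibres w B"
  shows "weight_gf (\<lambda>(x, y). v x + w y) (A \<times> B) = weight_gf v A * weight_gf w B"
proof (rule fps_ext)
  fix n
  have "{p \<in> A \<times> B. (\<lambda>(x, y). v x + w y) p = n} =
      (\<Union>k\<in>{0..n}. {x \<in> A. v x = k} \<times> {y \<in> B. w y = n - k})"
    by auto
  also have "card \<dots> = (\<Sum>k=0..n. card ({x \<in> A. v x = k} \<times> {y \<in> B. w y = n - k}))"
    using assms by (intro card_UN_disjoint) (auto simp: finite_fibres_def)
  finally show "fps_nth (weight_gf (\<lambda>(x, y). v x + w y) (A \<times> B)) n =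
      fps_nth (weight_gf v A * weight_gf w B) n"
    by (simp add: weight_gf_def fps_mult_nth card_cartesian_product)
qed

lemma weight_gf_singleton: "w x = 0 \<Longrightarrow> weight_gf w {x} = 1"
proof (rule fps_ext)
  fix n assume "w x = 0"
  then have "{y \<in> {x}. w y = n} = (if n = 0 then {x} else {})" by auto
  then show "fps_nth (weight_gf w {x}) n = fps_nth 1 n"
    by (simp add: weight_gf_def)
qed

section \<open>Paths weakly above the diagonal\<close>

definition weakly_above :: "nat \<times> nat \<Rightarrow> bool" where
  "weakly_above p \<longleftrightarrow> fst p \<le> snd p"

text \<open>Phrasing the boundary \<open>i + 1\<close> through prefix sums from the origin makes it
  amenable to induction on the last step.\<close>

definition nonneg_path :: "(nat \<times> nat) list \<Rightarrow> bool" where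
  "nonneg_path xs \<longleftrightarrow> (\<forall>k\<le>length xs. weakly_above (sum_list (take k xs)))"

lemma has_right_boundary_Suc_iff: "has_right_boundary (\<lambda>i. i + 1) xs \<longleftrightarrow> nonneg_path xs"
proof
  assume *: "has_right_boundary (\<lambda>i. i + 1) xs"
  show "nonneg_path xs" unfolding nonneg_path_def
  proof (intro allI impI)
    fix k assume "k \<le> length xs"
    then have "sum_list (take k xs) \<in> path_nodes (0, 0) xs"
      by (force simp: path_nodes_def zero_prod_def[symmetric])
    then show "weakly_above (sum_list (take k xs))"
      using * by (cases "sum_list (take k xs)")
        (auto simp: has_right_boundary_def weakly_above_def less_Suc_eq_le)
  qed
next
  assume *: "nonneg_path xs"
  show "has_right_boundary (\<lambda>i. i + 1) xs" unfolding has_right_boundary_def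
  proof (intro allI impI)
    fix x i assume "(x, i) \<in> path_nodes (0, 0) xs"
    then obtain k where "k \<le> length xs" "sum_list (take k xs) = (x, i)"
      by (auto simp: path_nodes_def zero_prod_def[symmetric])
    then show "x < i + 1"
      using * by (force simp: nonneg_path_def weakly_above_def)
  qed
qed

lemma nonneg_path_Nil [simp]: "nonneg_path []"
  by (simp add: nonneg_path_def weakly_above_def)

lemma nonneg_path_snoc:
  "nonneg_path (xs @ [x]) \<longleftrightarrow> nonneg_path xs \<and> weakly_above (sum_list xs + x)"
proof -
  have *: "(\<forall>k\<le>Suc n. Q k) \<longleftrightarrow> (\<forall>k\<le>n. Q k) \<and> Q (Suc n)" for Q n
    using le_Suc_eq by auto
  show ?thesis
    unfolding nonneg_path_def length_append_singleton * by simp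
qed

lemma nonneg_path_append: "nonneg_path (xs @ ys) \<Longrightarrow> nonneg_path xs"
  by (induction ys rule: rev_induct) (auto simp: nonneg_path_snoc simp flip: append_assoc)

lemma nonneg_path_end: "nonneg_path xs \<Longrightarrow> weakly_above (sum_list xs)"
  by (auto simp: nonneg_path_def)

text \<open>Induction from the right: an exit already found in the prefix is kept; otherwise the
  last step is the exit.\<close>

lemma nonneg_path_first_exit:
  "\<not> nonneg_path xs \<Longrightarrow> \<exists>ys z zs. xs = ys @ z # zs \<and> nonneg_path ys \<and> \<not> nonneg_path (ys @ [z])"
proof (induction xs rule: rev_induct)
  case (snoc x xs)
  show ?case
  proof (cases "nonneg_path xs")
    case True
    with snoc.prems show ?thesis by blast
  next
    case False
    with snoc.IH obtain ys z zs
      where "xs @ [x] = ys @ z # (zs @ [x])" "nonneg_path ys" "\<not> nonneg_path (ys @ [z])"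
      by auto
    then show ?thesis by blast
  qed
qed simp

text \<open>Of \<open>ys\<close> and \<open>ys'\<close> one is a prefix of the other. A strictly
  longer one would contain the exit of the shorter one, although nonnegativity passes to
  prefixes.\<close>

lemma nonneg_path_first_exit_unique:
  assumes eq: "ys @ z # zs = ys' @ z' # zs'"
    and "nonneg_path ys" "\<not> nonneg_path (ys @ [z])"
    and "nonneg_path ys'" "\<not> nonneg_path (ys' @ [z'])"
  shows "ys = ys' \<and> zs = zs'"
proof -
  have *: "ys = ys'"
    if "ys @ us = ys'" "us @ z' # zs' = z # zs" "nonneg_path ys'" "\<not> nonneg_path (ys @ [z])"
    for ys us ys' zs zs' and z z' :: "nat \<times> nat"
    \<comment> \<open>A nonempty \<open>us\<close> starts with \<open>z\<close>, so
      \<open>ys @ [z]\<close> would be a prefix of \<open>ys'\<close>.\<close>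
    using that nonneg_path_append[of "ys @ [z]" "tl us"] by (cases us) auto
  from eq consider us where "ys @ us = ys'" "us @ z' # zs' = z # zs"
    | us where "ys' @ us = ys" "us @ z # zs = z' # zs'"
    unfolding append_eq_append_conv2 by auto
  then have "ys = ys'"
    by cases (use * assms in blast)+
  with eq show ?thesis by simp
qed

text \<open>The instance \<open>i = 0\<close>, \<open>j = b\<close> reads
  \<open>b + 1 > a\<close>.\<close>

lemma slope_condition_Suc:
  assumes "slope_condition S (\<lambda>i. i + 1)" "(a, b) \<in> S" "b \<noteq> 0"
  shows "a \<le> b"
proof -
  have "b \<in> {1..b}" using assms(3) by simp
  then have "(of_nat (0 + b + 1) :: rat) > of_nat (0 + 1) - 1 + of_nat b * of_nat a / of_nat b"
    using assms unfolding slope_condition_def by blast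
  then have "(of_nat a :: rat) < of_nat (b + 1)"
    using assms(3) by simp
  then show ?thesis unfolding of_nat_less_iff by simp
qed

section \<open>The two decompositions\<close>

abbreviation end_level :: "(nat \<times> nat) list \<Rightarrow> nat" where
  "end_level xs \<equiv> snd (sum_list xs)"

text \<open>Paths of final height at least \<open>k\<close>: the cases \<open>k = 0\<close> and
  \<open>k = 1\<close> give the two sums of diagonal series in the theorem.\<close>

definition upper_paths :: "(nat \<times> nat) set \<Rightarrow> nat \<Rightarrow> (nat \<times> nat) list set" where
  "upper_paths S k = {xs. set xs \<subseteq> S \<and> fst (sum_list xs) + k \<le> snd (sum_list xs)}"

definition bridges :: "(nat \<times> nat) set \<Rightarrow> (nat \<times> nat) list set" where
  "bridges S = {xs. set xs \<subseteq> S \<and> fst (sum_list xs) = snd (sum_list xs)}"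

lemma upper_paths_fibre:
  "{xs \<in> upper_paths S k. end_level xs = n} =
     (\<Union>h\<in>{h. k + h \<le> n}. S_paths S (0, 0) (n - (k + h), n))"
proof (intro set_eqI iffI)
  fix xs assume *: "xs \<in> {xs \<in> upper_paths S k. end_level xs = n}"
  \<comment> \<open>The index \<open>h\<close> is the excess of the final height over
    \<open>k\<close>.\<close>
  then have "k + (n - k - fst (sum_list xs)) \<le> n"
      "xs \<in> S_paths S (0, 0) (n - (k + (n - k - fst (sum_list xs))), n)"
    by (auto simp: upper_paths_def S_paths_def zero_prod_def[symmetric] prod_eq_iff)
  then show "xs \<in> (\<Union>h\<in>{h. k + h \<le> n}. S_paths S (0, 0) (n - (k + h), n))"
    by blast
qed (auto simp: upper_paths_def S_paths_def zero_prod_def[symmetric])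

lemma finite_fibres_upper_paths:
  assumes "(0, 0) \<notin> S"
  shows "finite_fibres end_level (upper_paths S k)"
proof -
  have "finite {h. k + h \<le> n}" for n
    by (rule finite_subset[of _ "{..n}"]) auto
  then show ?thesis
    unfolding finite_fibres_def upper_paths_fibre using finite_S_paths[OF assms] by auto
qed

lemma suminf_diagonal_gf:
  assumes "(0, 0) \<notin> S"
  shows "(\<Sum>h. diagonal_gf S (k + h)) = weight_gf end_level (upper_paths S k)"
proof (rule fps_ext)
  fix n
  have fin: "finite {h. k + h \<le> n}"
    by (rule finite_subset[of _ "{..n}"]) auto
  have "card {xs \<in> upper_paths S k. end_level xs = n} =
      (\<Sum>h | k + h \<le> n. card (S_paths S (0, 0) (n - (k + h), n)))"
    unfolding upper_paths_fibre using fin finite_S_paths[OF assms]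
    by (intro card_UN_disjoint) (auto simp: S_paths_def)
  then show "fps_nth (\<Sum>h. diagonal_gf S (k + h)) n =
      fps_nth (weight_gf end_level (upper_paths S k)) n"
    by (simp add: sums_unique[OF diagonal_gf_sums, symmetric] weight_gf_def num_paths_def)
qed

lemma catalan_gf_eq: "catalan_gf S = weight_gf end_level {xs \<in> bridges S. nonneg_path xs}"
proof (rule fps_ext)
  fix n
  have "{xs \<in> S_paths S (0, 0) (n, n). nonneg_path xs} =
      {xs \<in> {xs \<in> bridges S. nonneg_path xs}. end_level xs = n}"
    by (auto simp: bridges_def S_paths_def zero_prod_def[symmetric] prod_eq_iff)
  then show "fps_nth (catalan_gf S) n =
      fps_nth (weight_gf end_level {xs \<in> bridges S. nonneg_path xs}) n"
    by (simp add: catalan_gf_def weight_gf_def num_catalan_paths_def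
        has_right_boundary_Suc_iff[simplified])
qed

lemma finite_fibres_id: "finite_fibres (\<lambda>a. a) A"
  by (simp add: finite_fibres_def)

lemma diagonal_steps_gf_eq: "diagonal_steps_gf S = weight_gf (\<lambda>a. a) {a. (a, a) \<in> S}"
proof (rule fps_ext)
  fix n
  have "{x \<in> {a. (a, a) \<in> S}. x = n} = (if (n, n) \<in> S then {n} else {})" by auto
  then show "fps_nth (diagonal_steps_gf S) n = fps_nth (weight_gf (\<lambda>a. a) {a. (a, a) \<in> S}) n"
    by (simp add: diagonal_steps_gf_def weight_gf_def)
qed

section \<open>Cutting paths at the first exit and at the last step\<close>

context
  fixes S :: "(nat \<times> nat) set"
  assumes zero: "(0, 0) \<notin> S"
    and horizontal: "\<And>a. a > 0 \<Longrightarrow> (a, 0) \<in> S"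
    and slope: "slope_condition S (\<lambda>i. i + 1)"
begin

lemma steep: "(a, b) \<in> S \<Longrightarrow> b \<noteq> 0 \<Longrightarrow> a \<le> b"
  using slope_condition_Suc[OF slope] .

text \<open>The inserted step has the sum of the two heights as its length, which brings the whole
  path back to height 0. The height of \<open>es\<close> is positive, so this step is an exit, and
  uniqueness of the first exit gives injectivity.\<close>

lemma bij_betw_first_exit:
  "bij_betw (\<lambda>(ws, es). ws @ (end_level ws + end_level es
       - fst (sum_list ws) - fst (sum_list es), 0) # es)
     ({xs \<in> upper_paths S 0. nonneg_path xs} \<times> upper_paths S 1)
     {xs \<in> bridges S. \<not> nonneg_path xs}"
    (is "bij_betw ?f (?W \<times> ?E) ?B")
proof -
  let ?step = "\<lambda>ws es. (end_level ws + end_level es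
       - fst (sum_list ws) - fst (sum_list es), 0 :: nat)"
  have exit: "\<not> nonneg_path (ws @ [?step ws es])" if "ws \<in> ?W" "es \<in> ?E" for ws es
    using that by (auto simp: nonneg_path_snoc upper_paths_def weakly_above_def)
  have mem: "?f (ws, es) \<in> ?B" if "ws \<in> ?W" "es \<in> ?E" for ws es
  proof -
    have "\<not> nonneg_path (ws @ ?step ws es # es)"
      using exit[OF that] nonneg_path_append[of "ws @ [?step ws es]" es] by auto
    moreover have "?step ws es \<in> S"
      using that by (intro horizontal) (auto simp: upper_paths_def)
    ultimately show ?thesis
      using that by (auto simp: bridges_def upper_paths_def)
  qed
  have "inj_on ?f (?W \<times> ?E)"
  proof (rule inj_onI, clarify)
    fix ws es ws' es'
    assume "ws \<in> upper_paths S 0" "nonneg_path ws" "es \<in> ?E"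
      "ws' \<in> upper_paths S 0" "nonneg_path ws'" "es' \<in> ?E"
      "ws @ ?step ws es # es = ws' @ ?step ws' es' # es'"
    then show "ws = ws' \<and> es = es'"
      using exit by (intro nonneg_path_first_exit_unique) auto
  qed
  moreover have "xs \<in> ?f ` (?W \<times> ?E)" if xs: "xs \<in> ?B" for xs
  proof -
    obtain ws a b es where split: "xs = ws @ (a, b) # es"
        and ws: "nonneg_path ws" and ex: "\<not> nonneg_path (ws @ [(a, b)])"
      using nonneg_path_first_exit[of xs] xs by auto
    have S: "(a, b) \<in> S" "set ws \<subseteq> S" "set es \<subseteq> S"
      using xs split by (auto simp: bridges_def)
    have above: "fst (sum_list ws) \<le> snd (sum_list ws)"
      using nonneg_path_end[OF ws] by (simp add: weakly_above_def)
    have below: "fst (sum_list ws) + a > snd (sum_list ws) + b"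
      using ex ws by (simp add: nonneg_path_snoc weakly_above_def)
    \<comment> \<open>A step with \<open>b \<noteq> 0\<close> has \<open>a \<le> b\<close> and could
      not lead below the diagonal.\<close>
    have b: "b = 0"
      using steep[OF S(1)] above below by fastforce
    have total: "fst (sum_list ws) + a + fst (sum_list es) = snd (sum_list ws) + snd (sum_list es)"
      using xs split b by (simp add: bridges_def)
    then have "?step ws es = (a, b)" using b by simp
    moreover have "ws \<in> ?W" "es \<in> ?E"
      using S ws above below total by (auto simp: upper_paths_def)
    ultimately show ?thesis
      using split by (intro image_eqI[of _ _ "(ws, es)"]) auto
  qed
  ultimately show ?thesis
    unfolding bij_betw_def using mem by auto
qed

text \<open>The last step must use up the whole height of \<open>ws\<close>, which is positive
  because \<open>(0, 0)\<close> is not a step.\<close>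

lemma bij_betw_last_horizontal:
  "bij_betw (\<lambda>ws. ws @ [(end_level ws - fst (sum_list ws), 0)])
     {xs \<in> upper_paths S 1. nonneg_path xs}
     {xs \<in> bridges S. nonneg_path xs \<and> xs \<noteq> [] \<and> snd (last xs) = 0}"
    (is "bij_betw ?f ?A ?B")
proof -
  have "?f ws \<in> ?B" if "ws \<in> ?A" for ws
    using that by (auto simp: bridges_def upper_paths_def nonneg_path_snoc weakly_above_def
        intro!: horizontal)
  moreover have "xs \<in> ?f ` ?A" if xs: "xs \<in> ?B" for xs
  proof -
    obtain ws a where split: "xs = ws @ [(a, 0)]"
      using xs by (cases xs rule: rev_cases) (auto simp: prod_eq_iff)
    have "a > 0"
      using xs split zero by (cases "a = 0") (auto simp: bridges_def)
    then show ?thesis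
      using xs split
      by (intro image_eqI[of _ _ ws]) (auto simp: bridges_def upper_paths_def nonneg_path_snoc)
  qed
  ultimately show ?thesis
    unfolding bij_betw_def by (auto simp: inj_on_def)
qed

text \<open>A last step with \<open>b \<noteq> 0\<close> does not lower the height. Since it starts
  at height at least 0 and ends at 0, both its start and the step itself have height 0.\<close>

lemma bij_betw_last_diagonal:
  "bij_betw (\<lambda>(ws, a). ws @ [(a, a)])
     ({xs \<in> bridges S. nonneg_path xs} \<times> {a. (a, a) \<in> S})
     {xs \<in> bridges S. nonneg_path xs \<and> xs \<noteq> [] \<and> snd (last xs) \<noteq> 0}"
    (is "bij_betw ?f ?A ?B")
proof -
  have "?f p \<in> ?B" if "p \<in> ?A" for p
    using that zero by (cases p, cases "snd p = 0")
      (auto simp: bridges_def nonneg_path_snoc weakly_above_def)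
  moreover have "xs \<in> ?f ` ?A" if xs: "xs \<in> ?B" for xs
  proof -
    obtain ws a b where split: "xs = ws @ [(a, b)]"
      using xs by (cases xs rule: rev_cases) auto
    have ab: "(a, b) \<in> S" "b \<noteq> 0" and ws: "set ws \<subseteq> S" "nonneg_path ws"
        and total: "fst (sum_list ws) + a = snd (sum_list ws) + b"
      using xs split by (auto simp: bridges_def nonneg_path_snoc)
    have "a = b" "fst (sum_list ws) = snd (sum_list ws)"
      using steep[OF ab] nonneg_path_end[OF ws(2)] total by (auto simp: weakly_above_def)
    then show ?thesis
      using split ab ws by (intro image_eqI[of _ _ "(ws, a)"]) (auto simp: bridges_def)
  qed
  ultimately show ?thesis
    unfolding bij_betw_def by (auto simp: inj_on_def)
qed

lemma catalan_gf_identity: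
  "catalan_gf S * (1 + (2 - diagonal_steps_gf S) * (\<Sum>h. diagonal_gf S (Suc h))) =
     (\<Sum>h. diagonal_gf S h)"
proof -
  let ?gf = "weight_gf end_level"
  define P where "P = {xs \<in> bridges S. nonneg_path xs}"
  define N where "N = {xs \<in> bridges S. \<not> nonneg_path xs}"
  define U where "U = {xs \<in> upper_paths S 1. nonneg_path xs}"
  define H where "H = {xs \<in> bridges S. nonneg_path xs \<and> xs \<noteq> [] \<and> snd (last xs) = 0}"
  define G where "G = {xs \<in> bridges S. nonneg_path xs \<and> xs \<noteq> [] \<and> snd (last xs) \<noteq> 0}"
  define W where "W = {xs \<in> upper_paths S 0. nonneg_path xs}"
  define E where "E = upper_paths S 1"
  note defs = P_def N_def U_def H_def G_def W_def E_def bridges_def upper_paths_def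
  have fin: "finite_fibres end_level A" if "A \<subseteq> upper_paths S 0" for A
    using finite_fibres_subset[OF finite_fibres_upper_paths[OF zero] that] .
  have fins: "finite_fibres end_level P" "finite_fibres end_level N"
    "finite_fibres end_level U" "finite_fibres end_level H"
    "finite_fibres end_level G" "finite_fibres end_level W"
    "finite_fibres end_level E" "finite_fibres end_level (P \<union> N)"
    "finite_fibres end_level (H \<union> G)" "finite_fibres end_level {[]}"
    \<comment> \<open>Every set here consists of paths of final height at least 0.\<close>
    by (rule fin, force simp: defs)+
  have "upper_paths S 0 = (P \<union> N) \<union> E" "(P \<union> N) \<inter> E = {}" "P \<inter> N = {}"
    by (auto simp: defs)
  then have all: "?gf (upper_paths S 0) = ?gf P + ?gf N + ?gf E"
    by (simp add: weight_gf_Un fins)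
  have "W = P \<union> U" "P \<inter> U = {}"
    by (auto simp: defs)
  then have W: "?gf W = ?gf P + ?gf U"
    by (simp add: weight_gf_Un fins)
  have "P = {[]} \<union> (H \<union> G)" "{[]} \<inter> (H \<union> G) = {}" "H \<inter> G = {}"
    by (auto simp: defs)
  then have P: "?gf P = 1 + (?gf H + ?gf G)"
    using weight_gf_Un[of end_level "{[]}" "H \<union> G"] weight_gf_Un[of end_level H G] fins
    by (simp add: weight_gf_singleton)
  \<comment> \<open>The inserted step is horizontal, so the end levels of the two pieces simply add
    up.\<close>
  have N: "?gf N = ?gf W * ?gf E"
    using weight_gf_bij_betw[OF bij_betw_first_exit, of end_level
        "\<lambda>(ws, es). end_level ws + end_level es"]
      weight_gf_Times[of end_level W end_level E] fins
    unfolding N_def W_def E_def by (simp add: split_beta)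
  have H: "?gf H = ?gf U"
    using weight_gf_bij_betw[OF bij_betw_last_horizontal, of end_level end_level]
    unfolding H_def U_def by simp
  have G: "?gf G = ?gf P * diagonal_steps_gf S"
    using weight_gf_bij_betw[OF bij_betw_last_diagonal, of end_level
        "\<lambda>(ws, a). end_level ws + a"]
      weight_gf_Times[of end_level P "\<lambda>a. a" "{a. (a, a) \<in> S}"] fins finite_fibres_id
    unfolding G_def P_def diagonal_steps_gf_eq by (simp add: split_beta)
  have U: "?gf U = ?gf P - 1 - ?gf P * diagonal_steps_gf S"
    using P H G by (simp add: algebra_simps)
  have "(\<Sum>h. diagonal_gf S h) = ?gf (upper_paths S 0)" "(\<Sum>h. diagonal_gf S (Suc h)) = ?gf E"
    using suminf_diagonal_gf[OF zero, of 0] suminf_diagonal_gf[OF zero, of 1]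
    by (simp_all add: E_def)
  then show ?thesis
    \<comment> \<open>With \<open>T\<close> for \<open>diagonal_steps_gf S\<close>, the series
      satisfy \<open>W = P + U = 2 P - 1 - P T\<close>. In \<open>P + W E + E\<close> the term
      \<open>- E\<close> cancels against \<open>E\<close>, leaving
      \<open>P (1 + (2 - T) E)\<close>.\<close>
    unfolding catalan_gf_eq P_def[symmetric] by (simp add: all N W U algebra_simps)
qed

end

theorem theorem2p3:
  fixes S :: "(nat \<times> nat) set"
  assumes "(0, 0) \<notin> S"
    and "\<And>a. a > 0 \<Longrightarrow> (a, 0) \<in> S"
    and "slope_condition S (\<lambda>i. i + 1)"
  shows "catalan_gf S =
    (\<Sum>h. diagonal_gf S h) /
      (1 + (2 - diagonal_steps_gf S) * (\<Sum>h. diagonal_gf S (Suc h)))"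
proof -
  define Q where "Q = 1 + (2 - diagonal_steps_gf S) * (\<Sum>h. diagonal_gf S (Suc h))"
  \<comment> \<open>No path of positive height ends at level 0; hence \<open>Q\<close> has constant
    term 1 and may be cancelled.\<close>
  have "fps_nth (\<Sum>h. diagonal_gf S (Suc h)) 0 = 0"
    using sums_unique[OF diagonal_gf_sums[of S 1], symmetric] by simp
  then have "fps_nth Q 0 = 1"
    by (simp add: Q_def)
  then have "Q \<noteq> 0" by auto
  then have "catalan_gf S * Q / Q = catalan_gf S"
    by (rule nonzero_mult_div_cancel_right)
  moreover have "catalan_gf S * Q = (\<Sum>h. diagonal_gf S h)"
    unfolding Q_def by (rule catalan_gf_identity[OF assms])
  ultimately show ?thesis
    unfolding Q_def by simp
qed

end
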